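(* Let $f,g:[0,b]\to[0,b]$ be continuous unimodal Allee maps with fixed points $0<A_f<K_f$ and $0<A_g<K_g$, with maxima $M_f=f(B_f)$ and $M_g=g(B_g)$ attained at $B_f$ and $B_g$ respectively, and with $b=\max(M_f,M_g)$. Let $p\in(0,1)$ and $\delta>0$, and let $\{Y_n\}_{n=0}^\infty$ be the random dynamical system with $Y_0=y_0\in[0,b]$ in which $Y_{n+1}=\chi(f(Y_n)+\varepsilon_n)$ with probability $p$ and $Y_{n+1}=\chi(g(Y_n)+\varepsilon_n)$ with probability $1-p$, where the $\varepsilon_n$ are i.i.d. continuous random variables taking values in $(-\delta,\delta)$ with a density that is positive on $(-\delta,\delta)$. Let $f$ be differentiable and $|f'(x)|<1$ for every $x\in(B_f,M_f)$. Assume that there exist functions $h_1,h_2,\ldots,h_m\in\{f,g\}$ for which $h_1\circ h_2\circ\cdots\circ h_m(K_f)<A_f$. If, in addition, the set $$U=\{x\in[0,\min(A_f,A_g)]:\ \min(x-f(x),\,x-g(x))\ge\delta\}$$ is nonempty, then $$P\left(\exists n_0\in\mathbb{N}:\ Y_n\in[0,\inf U)\ \ \forall n\ge n_0\right)=1$$ for every $y_0\in[0,b]$.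
   Context: A function $f:[0,b]\to[0,b]$ is called an Allee map if: it has exactly three fixed points, namely $0$, which is a stable fixed point, an unstable fixed point (threshold) $A_f>0$, and a fixed point $K_f>A_f$ (which may or may not be stable); $f(x)<x$ for all $x\in(0,A_f)\cup(K_f,b]$; and $f(x)>x$ for all $x\in(A_f,K_f)$. A continuous Allee map $f$ is unimodal if there exists $B_f\in(A_f,K_f)$ such that $f$ is strictly increasing on $(0,B_f)$ and strictly decreasing on $(B_f,b)$; $M_f=f(B_f)$ denotes its maximum. The notation $A_g,K_g,B_g,M_g$ is the analogous one for $g$. The function $\chi:\mathbb{R}\to\mathbb{R}$ is the truncation to $[0,b]$: $\chi(x)=0$ if $x<0$, $\chi(x)=x$ if $x\in[0,b]$, $\chi(x)=b$ if $x>b$. Formally, $Y_{n+1}=\chi(H_n(Y_n)+\varepsilon_n)$, where the $H_n$ are i.i.d. random functions with $P(H_n=f)=p$ and $P(H_n=g)=1-p$, the sequence $(H_n)$ is independent of the sequence $(\varepsilon_n)$, and $y_0$ is deterministic. *)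

theory Defs
  imports "HOL-Probability.Probability"
begin

text \<open>Stability is relative to the phase space \<open>S\<close>: only orbits starting in \<open>S\<close> are considered.\<close>

definition stable_fixed_point :: "real set \<Rightarrow> (real \<Rightarrow> real) \<Rightarrow> real \<Rightarrow> bool" where
  "stable_fixed_point S f x \<longleftrightarrow> x \<in> S \<and> f x = x \<and>
     (\<forall>e>0. \<exists>d>0. \<forall>y\<in>S. dist y x < d \<longrightarrow> (\<forall>n. dist ((f ^^ n) y) x < e))"

definition unstable_fixed_point :: "real set \<Rightarrow> (real \<Rightarrow> real) \<Rightarrow> real \<Rightarrow> bool" where
  "unstable_fixed_point S f x \<longleftrightarrow> x \<in> S \<and> f x = x \<and> \<not> stable_fixed_point S f x"

text \<open>
  Maps of \<open>[0,b]\<close> are represented by total functions on the reals; values outside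
  \<open>[0,b]\<close> are irrelevant. The parameters \<open>A\<close>, \<open>K\<close> and \<open>B\<close> below
  are uniquely determined by \<open>b\<close> and \<open>f\<close>.
\<close>

definition allee_map :: "real \<Rightarrow> (real \<Rightarrow> real) \<Rightarrow> real \<Rightarrow> real \<Rightarrow> bool" where
  "allee_map b f A K \<longleftrightarrow>
     f \<in> {0..b} \<rightarrow> {0..b} \<and>
     0 < A \<and> A < K \<and>
     {x\<in>{0..b}. f x = x} = {0, A, K} \<and>
     stable_fixed_point {0..b} f 0 \<and>
     unstable_fixed_point {0..b} f A \<and>
     (\<forall>x\<in>{0<..<A} \<union> {K<..b}. f x < x) \<and>
     (\<forall>x\<in>{A<..<K}. f x > x)"

definition unimodal_allee_map ::
    "real \<Rightarrow> (real \<Rightarrow> real) \<Rightarrow> real \<Rightarrow> real \<Rightarrow> real \<Rightarrow> bool" where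
  "unimodal_allee_map b f A K B \<longleftrightarrow>
     allee_map b f A K \<and>
     continuous_on {0..b} f \<and>
     B \<in> {A<..<K} \<and>
     strict_mono_on {0<..<B} f \<and>
     strict_antimono_on {B<..<b} f"

definition truncation :: "real \<Rightarrow> real \<Rightarrow> real" where
  "truncation b x = (if x < 0 then 0 else if x \<le> b then x else b)"

primrec random_orbit ::
    "real \<Rightarrow> (nat \<Rightarrow> 'w \<Rightarrow> real \<Rightarrow> real) \<Rightarrow> (nat \<Rightarrow> 'w \<Rightarrow> real) \<Rightarrow> real \<Rightarrow> nat \<Rightarrow> 'w \<Rightarrow> real" where
  "random_orbit b H \<epsilon> y\<^sub>0 0 \<omega> = y\<^sub>0"
| "random_orbit b H \<epsilon> y\<^sub>0 (Suc n) \<omega> =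
     truncation b (H n \<omega> (random_orbit b H \<epsilon> y\<^sub>0 n \<omega>) + \<epsilon> n \<omega>)"

text \<open>
  Independence of two random elements with values in spaces of possibly different types
  (the library constant \<open>prob_space.indep_var\<close> requires both to have the same type).
\<close>

definition indep_random_elements ::
    "'w measure \<Rightarrow> 'a measure \<Rightarrow> ('w \<Rightarrow> 'a) \<Rightarrow> 'b measure \<Rightarrow> ('w \<Rightarrow> 'b) \<Rightarrow> bool" where
  "indep_random_elements M N X N' X' \<longleftrightarrow>
     X \<in> measurable M N \<and> X' \<in> measurable M N' \<and>
     prob_space.indep_set M {X -` A \<inter> space M | A. A \<in> sets N}
                            {X' -` A \<inter> space M | A. A \<in> sets N'}"

end

theory Submission imports Defs begin

text \<open>
  Write \<open>u = Inf U\<close>. Both maps are increasing on \<open>[0,u]\<close> and drop by at least \<open>\<delta>\<close> at \<open>u\<close>, so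
  \<open>[0,u)\<close> is almost surely absorbing. Call a set accessible if, from every state in it and at any
  time, the orbit lies in \<open>[0,u)\<close> a fixed number of steps later with probability at least some fixed
  \<open>c > 0\<close>. Once the whole interval \<open>[0,b]\<close> is accessible, the probability of not having been
  absorbed decays geometrically.

  The set \<open>C\<close> of points with no accessible neighbourhood is compact and invariant under every
  step \<open>y \<mapsto> \<chi>(h(y) + e)\<close> with \<open>h \<in> {f,g}\<close> and \<open>|e| < \<delta>\<close>. Suppose it is nonempty. Its minimum
  \<open>c\<close> is positive and satisfies \<open>f(c) \<ge> c\<close>, hence \<open>c \<ge> A\<^sub>f\<close>, and \<open>c = A\<^sub>f\<close> is excluded by a small
  negative perturbation. The derivative bound makes \<open>f\<close> move every point of \<open>(A\<^sub>f, M\<^sub>f]\<close> other than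
  \<open>K\<^sub>f\<close> strictly closer to \<open>K\<^sub>f\<close>, so the point of \<open>C \<inter> [0, M\<^sub>f]\<close> nearest to \<open>K\<^sub>f\<close> is \<open>K\<^sub>f\<close> itself.
  Applying \<open>h\<^sub>1 \<circ> \<dots> \<circ> h\<^sub>m\<close> to it yields a point of \<open>C\<close> below \<open>A\<^sub>f\<close>, a contradiction.
\<close>

subsection \<open>Unimodal Allee maps\<close>

lemma truncation_eq: "0 \<le> b \<Longrightarrow> truncation b x = max 0 (min b x)"
  by (auto simp: truncation_def)

lemma truncation_mem: "0 \<le> b \<Longrightarrow> truncation b x \<in> {0..b}"
  by (auto simp: truncation_def)

lemma truncation_id: "x \<in> {0..b} \<Longrightarrow> truncation b x = x"
  by (auto simp: truncation_def)

lemma truncation_nonexpansive: "0 \<le> b \<Longrightarrow> dist (truncation b x) (truncation b y) \<le> dist x y"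
  by (auto simp: truncation_def dist_real_def)

text \<open>Unimodality gives monotonicity only on open intervals, while the end points
  \<open>0\<close>, \<open>B\<close> and \<open>b\<close> matter below. Continuity supplies them,
  the right end point first and then the left one.\<close>

lemma mono_on_closed_interval:
  fixes f :: "real \<Rightarrow> real"
  assumes cont: "continuous_on {a..c} f"
    and mono: "\<And>x y. a < x \<Longrightarrow> x < y \<Longrightarrow> y < c \<Longrightarrow> f x \<le> f y"
    and "a \<le> x" "x \<le> y" "y \<le> c"
  shows "f x \<le> f y"
proof -
  have right: "f s \<le> f t" if "a < s" "s < t" "t \<le> c" for s t
  proof (rule continuous_ge_on_closure[where S = "{s<..<c}" and f = f and x = t])
    show "continuous_on (closure {s<..<c}) f"
      using that by (auto intro: continuous_on_subset[OF cont])
    show "t \<in> closure {s<..<c}" using that by simp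
  qed (use that mono in auto)
  show ?thesis
  proof (cases "x = y \<or> a < x")
    case True
    then show ?thesis using right[of x y] assms(3-) by force
  next
    case False
    then have xy: "x = a" "a < y" using assms by auto
    show ?thesis
    proof (rule continuous_le_on_closure[where S = "{a<..<y}" and f = f and x = x])
      show "continuous_on (closure {a<..<y}) f"
        using xy assms by (auto intro: continuous_on_subset[OF cont])
      show "x \<in> closure {a<..<y}" using xy by simp
    qed (use right xy assms in auto)
  qed
qed

lemma unimodal_allee_mono:
  assumes "unimodal_allee_map b f A K B" and "0 \<le> x" "x \<le> y" "y \<le> B"
  shows "f x \<le> f y"
proof (rule mono_on_closed_interval[of 0 B f])
  have "K \<in> {0..b}" "B < K" "continuous_on {0..b} f"
    using assms(1) by (auto simp: unimodal_allee_map_def allee_map_def)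
  then show "continuous_on {0..B} f"
    by (auto intro: continuous_on_subset)
  fix x y assume "0 < x" "x < y" "y < B"
  then show "f x \<le> f y"
    using assms(1) by (auto simp: unimodal_allee_map_def monotone_on_def intro: less_imp_le)
qed (use assms in auto)

lemma unimodal_allee_le_max:
  assumes f: "unimodal_allee_map b f A K B" and x: "x \<in> {0..b}"
  shows "f x \<le> f B"
proof (cases "x \<le> B")
  case True
  then show ?thesis using unimodal_allee_mono[OF f, of x B] x by auto
next
  case False
  \<comment> \<open>Negation turns the decreasing branch into a nondecreasing one.\<close>
  have "- f B \<le> - f x"
  proof (rule mono_on_closed_interval[of B b "\<lambda>x. - f x"])
    have "0 < B" "continuous_on {0..b} f"
      using f by (auto simp: unimodal_allee_map_def allee_map_def)
    then show "continuous_on {B..b} (\<lambda>x. - f x)"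
      by (auto intro!: continuous_intros intro: continuous_on_subset)
    fix x y assume "B < x" "x < y" "y < b"
    then show "- f x \<le> - f y"
      using f by (auto simp: unimodal_allee_map_def monotone_on_def intro: less_imp_le)
  qed (use False x in auto)
  then show ?thesis by simp
qed

lemma unimodal_allee_bounds:
  assumes "unimodal_allee_map b f A K B"
  shows "0 < A" "A < B" "B < K" "K \<le> f B" "f B \<le> b" "K \<in> {0..b}" "f K = K" "f A = A" "B < f B"
    "A \<in> {0..b}"
proof -
  note f = assms[unfolded unimodal_allee_map_def allee_map_def]
  show "0 < A" "A < B" "B < K" using f by auto
  have K: "K \<in> {x\<in>{0..b}. f x = x}" and A: "A \<in> {x\<in>{0..b}. f x = x}" using f by auto
  show "K \<in> {0..b}" "f K = K" "f A = A" "A \<in> {0..b}" using K A by auto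
  then show "K \<le> f B" using unimodal_allee_le_max[OF assms, of K] by simp
  then show "B < f B" using \<open>B < K\<close> by simp
  have "B \<in> {0..b}" using \<open>0 < A\<close> \<open>A < B\<close> \<open>B < K\<close> \<open>K \<in> {0..b}\<close> by auto
  then have "f B \<in> {0..b}" using f by blast
  then show "f B \<le> b" by simp
qed

text \<open>By the mean value theorem \<open>f\<close> strictly shrinks distances on
  \<open>[B, f B]\<close>, which contains the fixed point \<open>K\<close>. For \<open>x < B\<close>
  the value \<open>f x\<close> either lies between \<open>x\<close> and \<open>K\<close> or exceeds
  \<open>K\<close> by at most \<open>f B - K\<close>, which is less than
  \<open>K - B\<close>.\<close>

lemma unimodal_allee_closer:
  assumes f: "unimodal_allee_map b f A K B"
    and deriv: "\<And>x. x \<in> {B<..<f B} \<Longrightarrow> f differentiable (at x) \<and> \<bar>deriv f x\<bar> < 1"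
    and x: "A < x" "x \<le> f B" "x \<noteq> K"
  shows "\<bar>f x - K\<bar> < \<bar>x - K\<bar>"
proof -
  note bd = unimodal_allee_bounds[OF f]
  have contraction: "\<bar>f t - f s\<bar> < t - s" if "B \<le> s" "s < t" "t \<le> f B" for s t
  proof -
    have "continuous_on {0..b} f" using f by (auto simp: unimodal_allee_map_def)
    then have "continuous_on {s..t} f"
      using that bd by (auto intro: continuous_on_subset)
    moreover have "f differentiable (at z)" if "s < z" "z < t" for z
      using deriv[of z] that \<open>B \<le> s\<close> \<open>t \<le> f B\<close> by auto
    ultimately obtain l z where z: "s < z" "z < t" "DERIV f z :> l" "f t - f s = (t - s) * l"
      using MVT[OF \<open>s < t\<close>, of f] by blast
    then have "\<bar>l\<bar> < 1" using deriv[of z] that DERIV_imp_deriv[OF z(3)] by auto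
    then have "(t - s) * \<bar>l\<bar> < (t - s) * 1"
      using that by (intro mult_strict_left_mono) auto
    then show ?thesis using z that by (simp add: abs_mult)
  qed
  consider "x < B" | "B \<le> x" "x < K" | "K < x" using x by linarith
  then show ?thesis
  proof cases
    case 1
    have "x < f x" using f x 1 bd by (auto simp: unimodal_allee_map_def allee_map_def)
    moreover have "f x \<le> f B" using unimodal_allee_le_max[OF f, of x] x bd 1 by auto
    moreover have "\<bar>f K - f B\<bar> < K - B" using bd by (intro contraction) auto
    ultimately show ?thesis using bd 1 by linarith
  next
    case 2
    then show ?thesis using contraction[of x K] bd by auto
  next
    case 3
    then show ?thesis using contraction[of K x] bd x by auto
  qed
qed

section \<open>Invariant compact sets\<close>

text \<open>The deterministic half of the argument, applied later to the set of points without an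
  accessible neighbourhood.\<close>

lemma unimodal_allee_no_invariant_compact:
  assumes f: "unimodal_allee_map b f A K B"
    and deriv: "\<And>x. x \<in> {B<..<f B} \<Longrightarrow> f differentiable (at x) \<and> \<bar>deriv f x\<bar> < 1"
    and g: "g \<in> {0..b} \<rightarrow> {0..b}"
    and word: "set hs \<subseteq> {f, g}" "foldr (\<circ>) hs id K < A"
    and "0 < \<delta>"
    and C: "compact C" "C \<subseteq> {0..b}" "0 \<notin> C"
    and inv: "\<And>y h e. y \<in> C \<Longrightarrow> h \<in> {f, g} \<Longrightarrow> \<bar>e\<bar> < \<delta> \<Longrightarrow> truncation b (h y + e) \<in> C"
  shows "C = {}"
proof (rule ccontr)
  assume "C \<noteq> {}"
  note bd = unimodal_allee_bounds[OF f]
  have maps: "h y \<in> {0..b}" if "h \<in> {f, g}" "y \<in> {0..b}" for h y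
    using that f g by (auto simp: unimodal_allee_map_def allee_map_def)
  \<comment> \<open>Zero noise is admissible and truncation fixes \<open>[0,b]\<close>, so
    \<open>C\<close> is invariant under the maps themselves.\<close>
  have inv0: "h y \<in> C" if "h \<in> {f, g}" "y \<in> C" for h y
  proof -
    have "h y \<in> {0..b}" using maps that C by blast
    then show ?thesis using inv[of y h 0] that \<open>0 < \<delta>\<close> by (simp add: truncation_id)
  qed
  obtain c where c: "c \<in> C" "\<And>y. y \<in> C \<Longrightarrow> c \<le> y"
    using compact_attains_inf[OF C(1) \<open>C \<noteq> {}\<close>] by blast
  have "0 < c" "c \<le> b" using c C by (auto simp: order.order_iff_strict)
  have "A \<le> c"
  proof (rule ccontr)
    assume "\<not> A \<le> c"
    then have "f c < c" using f \<open>0 < c\<close> by (auto simp: unimodal_allee_map_def allee_map_def)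
    then show False using c(2)[OF inv0[of f c]] c(1) by auto
  qed
  moreover have "c \<noteq> A"
  proof
    assume "c = A"
    \<comment> \<open>\<open>e < \<delta>\<close> makes the perturbation \<open>- e\<close>
      admissible, and \<open>e < A\<close> keeps \<open>A - e\<close> positive, so that truncation
      does not raise it.\<close>
    define e where "e = min A \<delta> / 2"
    have e: "0 < e" "e < \<delta>" "e < A" using bd \<open>0 < \<delta>\<close> by (auto simp: e_def min_def)
    have "truncation b (f c + (- e)) \<in> C" using c e by (intro inv) auto
    moreover have "truncation b (f c + (- e)) = A - e"
      using \<open>c = A\<close> bd e by (simp add: truncation_id)
    ultimately show False using c(2) \<open>c = A\<close> e by force
  qed
  ultimately have above: "A < y" if "y \<in> C" for y using c(2)[OF that] by linarith
  \<comment> \<open>The approach to \<open>K\<close> is available only up to \<open>f B\<close>. One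
    application of \<open>f\<close> lands there, so the restricted set is nonempty.\<close>
  have "f c \<in> C \<inter> {0..f B}"
    using C inv0[of f c] c unimodal_allee_le_max[OF f, of c] by auto
  then have "compact (C \<inter> {0..f B})" "C \<inter> {0..f B} \<noteq> {}"
    using C by (auto intro: compact_Int)
  then obtain z where "z \<in> C \<inter> {0..f B}" "\<And>y. y \<in> C \<inter> {0..f B} \<Longrightarrow> \<bar>z - K\<bar> \<le> \<bar>y - K\<bar>"
    using continuous_attains_inf[of "C \<inter> {0..f B}" "\<lambda>y. \<bar>y - K\<bar>"]
    by (force intro!: continuous_intros simp del: Int_iff)
  then have z: "z \<in> C" "z \<le> f B" "\<And>y. y \<in> C \<inter> {0..f B} \<Longrightarrow> \<bar>z - K\<bar> \<le> \<bar>y - K\<bar>"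
    by auto
  \<comment> \<open>\<open>f z\<close> competes with \<open>z\<close> for the minimum, hence cannot
    be strictly closer to \<open>K\<close>.\<close>
  have "f z \<in> C \<inter> {0..f B}"
    using inv0[of f z] z(1,2) C(2) unimodal_allee_le_max[OF f, of z] by auto
  then have "\<bar>z - K\<bar> \<le> \<bar>f z - K\<bar>" by (rule z(3))
  then have "z = K"
    using unimodal_allee_closer[OF f deriv above[OF z(1)] z(2)] by fastforce
  then have "K \<in> C" using z(1) by simp
  \<comment> \<open>Generalised to all words, so that the induction starts from the empty word,
    which gives \<open>K\<close> itself.\<close>
  have "foldr (\<circ>) ws id K \<in> C" if "set ws \<subseteq> {f, g}" for ws
    using that
  proof (induction ws)
    case Nil
    show ?case using \<open>K \<in> C\<close> by simp
  next
    case (Cons h ws)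
    from Cons.prems have "h \<in> {f, g}" "set ws \<subseteq> {f, g}" by auto
    from inv0[OF this(1) Cons.IH[OF this(2)]] show ?case by (simp only: foldr_Cons o_apply)
  qed
  from above[OF this[OF word(1)]] word(2) show False by linarith
qed

subsection \<open>Independence of the driving sequences\<close>

text \<open>A finite index set splits into its two summands. Independence of the two sequences
  separates the halves, and independence within each sequence factors each half.\<close>

lemma (in prob_space) indep_sets_combine:
  assumes X: "indep_vars N X UNIV" and X': "indep_vars N' X' UNIV"
    and indep: "indep_random_elements M (Pi\<^sub>M UNIV N) (\<lambda>\<omega> n. X n \<omega>) (Pi\<^sub>M UNIV N') (\<lambda>\<omega> n. X' n \<omega>)"
  shows "indep_sets (case_sum (\<lambda>i. {X i -` A \<inter> space M |A. A \<in> sets (N i)})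
                              (\<lambda>i. {X' i -` A \<inter> space M |A. A \<in> sets (N' i)})) UNIV"
    (is "indep_sets ?F UNIV")
proof (rule indep_setsI)
  have meas: "X i \<in> measurable M (N i)" "X' j \<in> measurable M (N' j)" for i j
    using X X' by (auto simp: indep_vars_def2)
  then show "?F i \<subseteq> events" for i
    by (auto split: sum.split)
  fix A :: "'b + 'd \<Rightarrow> 'a set" and J assume J: "J \<noteq> {}" "finite J" and A: "\<forall>j\<in>J. A j \<in> ?F j"
  define J1 where "J1 = Inl -` J"
  define J2 where "J2 = Inr -` J"
  have fin: "finite J1" "finite J2"
    using J by (auto simp: J1_def J2_def intro: finite_vimageI)
  have J_eq: "J = Inl ` J1 \<union> Inr ` J2"
  proof (intro set_eqI)
    show "j \<in> J \<longleftrightarrow> j \<in> Inl ` J1 \<union> Inr ` J2" for j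
      by (cases j) (auto simp: J1_def J2_def)
  qed
  have "\<forall>i\<in>J1. \<exists>S. S \<in> sets (N i) \<and> A (Inl i) = X i -` S \<inter> space M"
    using A by (force simp: J1_def)
  then obtain S where S: "\<And>i. i \<in> J1 \<Longrightarrow> S i \<in> sets (N i)" "\<And>i. i \<in> J1 \<Longrightarrow> A (Inl i) = X i -` S i \<inter> space M"
    by metis
  have "\<forall>i\<in>J2. \<exists>S. S \<in> sets (N' i) \<and> A (Inr i) = X' i -` S \<inter> space M"
    using A by (force simp: J2_def)
  then obtain S' where S': "\<And>i. i \<in> J2 \<Longrightarrow> S' i \<in> sets (N' i)" "\<And>i. i \<in> J2 \<Longrightarrow> A (Inr i) = X' i -` S' i \<inter> space M"
    by metis
  \<comment> \<open>Comprehensions rather than intersections, so that an empty half gives the whole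
    space, of probability 1.\<close>
  define P where "P = {\<omega>\<in>space M. \<forall>i\<in>J1. X i \<omega> \<in> S i}"
  define P' where "P' = {\<omega>\<in>space M. \<forall>i\<in>J2. X' i \<omega> \<in> S' i}"
  have PQ: "(\<Inter>j\<in>J. A j) = P \<inter> P'"
    using J unfolding J_eq P_def P'_def by (auto simp: S S' ball_Un)
  have prob_P: "prob P = (\<Prod>i\<in>J1. prob (A (Inl i)))"
  proof (cases "J1 = {}")
    case True then show ?thesis by (simp add: P_def prob_space)
  next
    case False
    then have "P = (\<Inter>i\<in>J1. A (Inl i))" by (auto simp: P_def S)
    moreover have "prob (\<Inter>i\<in>J1. A (Inl i)) = (\<Prod>i\<in>J1. prob (A (Inl i)))"
      using X False fin S by (intro indep_setsD) (auto simp: indep_vars_def2)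
    ultimately show ?thesis by simp
  qed
  have prob_P': "prob P' = (\<Prod>i\<in>J2. prob (A (Inr i)))"
  proof (cases "J2 = {}")
    case True then show ?thesis by (simp add: P'_def prob_space)
  next
    case False
    then have "P' = (\<Inter>i\<in>J2. A (Inr i))" by (auto simp: P'_def S')
    moreover have "prob (\<Inter>i\<in>J2. A (Inr i)) = (\<Prod>i\<in>J2. prob (A (Inr i)))"
      using X' False fin S' by (intro indep_setsD) (auto simp: indep_vars_def2)
    ultimately show ?thesis by simp
  qed
  have "prob (P \<inter> P') = prob P * prob P'"
  proof -
    \<comment> \<open>\<open>P\<close> and \<open>P'\<close> are preimages of these cylinder sets,
      to which the independence of the whole sequences applies.\<close>
    define T where "T = {x\<in>space (Pi\<^sub>M UNIV N). \<forall>i\<in>J1. x i \<in> S i}"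
    define T' where "T' = {x\<in>space (Pi\<^sub>M UNIV N'). \<forall>i\<in>J2. x i \<in> S' i}"
    have "{x\<in>space (Pi\<^sub>M UNIV N). x i \<in> S i} \<in> sets (Pi\<^sub>M UNIV N)" if "i \<in> J1" for i
      using S(1)[OF that] by measurable
    moreover have "{x\<in>space (Pi\<^sub>M UNIV N'). x i \<in> S' i} \<in> sets (Pi\<^sub>M UNIV N')" if "i \<in> J2" for i
      using S'(1)[OF that] by measurable
    ultimately have T: "T \<in> sets (Pi\<^sub>M UNIV N)" "T' \<in> sets (Pi\<^sub>M UNIV N')"
      unfolding T_def T'_def using fin by (auto intro!: sets.sets_Collect_finite_All)
    have "P = (\<lambda>\<omega> n. X n \<omega>) -` T \<inter> space M" "P' = (\<lambda>\<omega> n. X' n \<omega>) -` T' \<inter> space M"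
      using meas[THEN measurable_space] by (auto simp: P_def P'_def T_def T'_def space_PiM)
    then show ?thesis
      using indep T unfolding indep_random_elements_def by (intro indep_setD) auto
  qed
  then show "prob (\<Inter>j\<in>J. A j) = (\<Prod>j\<in>J. prob (A j))"
    unfolding PQ prob_P prob_P' unfolding J_eq
    using fin by (subst prod.union_disjoint) (auto simp: prod.reindex)
qed

subsection \<open>The randomly perturbed system\<close>

text \<open>The Allee structure enters only through continuity and \<open>trap\<close>, with
  \<open>u\<close> standing for \<open>Inf U\<close>. The absence of invariant compact sets is a
  separate hypothesis of \<open>eventually_trapped\<close>.\<close>

locale random_system = prob_space M for M :: "'w measure" +
  fixes f g :: "real \<Rightarrow> real" and b p \<delta> y\<^sub>0 u :: real
    and H :: "nat \<Rightarrow> 'w \<Rightarrow> real \<Rightarrow> real" and \<epsilon> :: "nat \<Rightarrow> 'w \<Rightarrow> real" and \<rho> :: "real \<Rightarrow> ennreal"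
  assumes b_nonneg: "0 \<le> b" and y0: "y\<^sub>0 \<in> {0..b}"
    and cont: "\<And>h. h \<in> {f, g} \<Longrightarrow> continuous_on {0..b} h"
    and p: "0 < p" "p < 1"
    and indep_H: "indep_vars (\<lambda>_. count_space {f, g}) H UNIV"
    and prob_f: "\<And>n. prob {\<omega>\<in>space M. H n \<omega> = f} = p"
    and prob_g: "\<And>n. prob {\<omega>\<in>space M. H n \<omega> = g} = 1 - p"
    and indep_noise: "indep_vars (\<lambda>_. borel) \<epsilon> UNIV"
    and density: "\<And>n. distributed M lborel (\<epsilon> n) \<rho>"
    and noise_bounded: "\<And>n. AE \<omega> in M. \<epsilon> n \<omega> \<in> {-\<delta><..<\<delta>}"
    and density_pos: "\<And>x. x \<in> {-\<delta><..<\<delta>} \<Longrightarrow> 0 < \<rho> x"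
    and indep_both: "indep_random_elements M
          (Pi\<^sub>M UNIV (\<lambda>_. count_space {f, g})) (\<lambda>\<omega> n. H n \<omega>)
          (Pi\<^sub>M UNIV (\<lambda>_. borel)) (\<lambda>\<omega> n. \<epsilon> n \<omega>)"
    and trap: "\<And>h x. h \<in> {f, g} \<Longrightarrow> x \<in> {0..<u} \<Longrightarrow> h x + \<delta> \<le> u"
    and trap_pos: "0 < u"
begin

abbreviation "Y \<equiv> random_orbit b H \<epsilon> y\<^sub>0"

text \<open>\<^term>\<open>Inl i\<close> indexes the choice of map at time \<^term>\<open>i\<close>, \<^term>\<open>Inr i\<close> the noise at time \<^term>\<open>i\<close>.\<close>

definition coord :: "nat + nat \<Rightarrow> 'w set set" where
  "coord = case_sum (\<lambda>i. {H i -` A \<inter> space M |A. A \<in> sets (count_space {f, g})})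
                    (\<lambda>i. {\<epsilon> i -` A \<inter> space M |A. A \<in> sets borel})"

text \<open>The natural filtration of the driving sequences. Time \<open>k\<close> is excluded:
  \<open>Y k\<close> is measurable for \<open>past k\<close>, while the map and the noise at time
  \<open>k\<close> are independent of it.\<close>

definition past :: "nat \<Rightarrow> 'w measure" where
  "past k = sigma (space M) (\<Union>i\<in>Inl ` {..<k} \<union> Inr ` {..<k}. coord i)"

section \<open>Independence of the past, the map and the noise\<close>

lemma indep_coord: "indep_sets coord UNIV"
  unfolding coord_def by (rule indep_sets_combine[OF indep_H indep_noise indep_both])

text \<open>Lets independence pass from the generators to the generated sigma-algebras in
  \<open>prob_one_step\<close>.\<close>

lemma Int_stable_coord: "Int_stable (coord i)"
proof (cases i)
  case (Inl n)
  have "\<exists>C. H n -` A \<inter> space M \<inter> (H n -` B \<inter> space M) = H n -` C \<inter> space M \<and> C \<subseteq> {f, g}"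
    if "A \<subseteq> {f, g}" for A B
    using that by (intro exI[of _ "A \<inter> B"]) auto
  then show ?thesis by (auto simp: Int_stable_def coord_def Inl)
next
  case (Inr n)
  have "\<exists>C. \<epsilon> n -` A \<inter> space M \<inter> (\<epsilon> n -` B \<inter> space M) = \<epsilon> n -` C \<inter> space M \<and> C \<in> sets borel"
    if "A \<in> sets borel" "B \<in> sets borel" for A B
    using that by (intro exI[of _ "A \<inter> B"]) auto
  then show ?thesis by (auto simp: Int_stable_def coord_def Inr)
qed

lemma coord_subset_Pow: "coord i \<subseteq> Pow (space M)"
  by (auto simp: coord_def split: sum.splits)

lemma space_past: "space (past k) = space M"
  unfolding past_def by (rule space_measure_of) (use coord_subset_Pow in blast)

lemma sets_past: "sets (past k) = sigma_sets (space M) (\<Union>i\<in>Inl ` {..<k} \<union> Inr ` {..<k}. coord i)"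
  unfolding past_def by (rule sets_measure_of) (use coord_subset_Pow in blast)

lemma sets_past_subset: "sets (past k) \<subseteq> sets M"
  unfolding sets_past using indep_coord
  by (intro sets.sigma_sets_subset) (auto simp: indep_sets_def)

lemma sets_past_mono: "k \<le> l \<Longrightarrow> sets (past k) \<subseteq> sets (past l)"
  unfolding sets_past by (intro sigma_sets_mono') force

lemma coord_in_past:
  assumes "n < k"
  shows "A \<subseteq> {f, g} \<Longrightarrow> H n -` A \<inter> space M \<in> sets (past k)"
    and "B \<in> sets borel \<Longrightarrow> \<epsilon> n -` B \<inter> space M \<in> sets (past k)"
proof -
  show "H n -` A \<inter> space M \<in> sets (past k)" if "A \<subseteq> {f, g}"
    unfolding sets_past using assms that
    by (intro sigma_sets.Basic UN_I[of "Inl n"]) (auto simp: coord_def)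
  show "\<epsilon> n -` B \<inter> space M \<in> sets (past k)" if "B \<in> sets borel"
    unfolding sets_past using assms that
    by (intro sigma_sets.Basic UN_I[of "Inr n"]) (auto simp: coord_def)
qed

text \<open>Disjoint groups of independent coordinates generate independent sigma-algebras. This
  takes the place of the Markov property.\<close>

lemma prob_one_step:
  assumes E: "E \<in> sets (past k)" and A: "A \<subseteq> {f, g}" and B: "B \<in> sets borel"
  shows "prob (E \<inter> (H k -` A \<inter> space M) \<inter> (\<epsilon> k -` B \<inter> space M)) =
    prob E * prob (H k -` A \<inter> space M) * prob (\<epsilon> k -` B \<inter> space M)"
proof -
  define I :: "nat \<Rightarrow> (nat + nat) set"
    where "I j = (if j = 0 then Inl ` {..<k} \<union> Inr ` {..<k} else if j = 1 then {Inl k} else {Inr k})" for j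
  define S where "S j = sigma_sets (space M) (\<Union>i\<in>I j. coord i)" for j
  have "indep_sets S {0, 1, 2}"
    unfolding S_def
  proof (rule indep_sets_collect_sigma)
    show "indep_sets coord (\<Union>j\<in>{0, 1, 2}. I j)"
      using indep_coord by (rule indep_sets_mono_index[rotated]) simp
    show "disjoint_family_on I {0, 1, 2}"
      by (auto simp: disjoint_family_on_def I_def)
  qed (rule Int_stable_coord)
  moreover define Z where
    "Z j = (if j = 0 then E else if j = 1 then H k -` A \<inter> space M else \<epsilon> k -` B \<inter> space M)" for j :: nat
  have "\<forall>j\<in>{0, 1, 2}. Z j \<in> S j"
    using E A B by (auto simp: Z_def S_def I_def sets_past coord_def)
  ultimately have "prob (\<Inter>j\<in>{0, 1, 2}. Z j) = (\<Prod>j\<in>{0, 1, 2}. prob (Z j))"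
    by (intro indep_setsD) auto
  moreover have "(\<Inter>j\<in>{0, 1, 2}. Z j) = E \<inter> (H k -` A \<inter> space M) \<inter> (\<epsilon> k -` B \<inter> space M)"
    by (auto simp: Z_def)
  ultimately show ?thesis by (simp add: Z_def mult.assoc)
qed

text \<open>The density is positive on the overlap of the ball with the noise range, an interval of
  positive length because \<open>e\<close> lies inside both. All noises share the density, so
  \<open>c\<close> serves every time.\<close>

lemma prob_noise_ball:
  assumes "0 < r" and "\<bar>e\<bar> < \<delta>"
  obtains c where "0 < c" "\<And>k. prob (\<epsilon> k -` ball e r \<inter> space M) = c"
proof
  define m where "m = (\<integral>\<^sup>+x. \<rho> x * indicator (ball e r) x \<partial>lborel)"
  have m: "emeasure M (\<epsilon> k -` ball e r \<inter> space M) = m" for k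
    unfolding m_def by (rule distributed_emeasure[OF density]) simp
  then show "prob (\<epsilon> k -` ball e r \<inter> space M) = enn2real m" for k
    by (simp add: measure_def)
  have "m < \<top>" unfolding m[of 0, symmetric] by (simp add: emeasure_eq_measure)
  moreover have "m \<noteq> 0"
  proof
    assume "m = 0"
    have [measurable]: "\<rho> \<in> borel_measurable borel"
      using density[of 0] by (simp add: distributed_def)
    have [measurable]: "ball e r \<in> sets borel" by simp
    have "m = 0 \<longleftrightarrow> (AE x in lborel. \<rho> x * indicator (ball e r) x = 0)"
      unfolding m_def by (rule nn_integral_0_iff_AE) measurable
    with \<open>m = 0\<close> have "AE x in lborel. \<rho> x * indicator (ball e r) x = 0" by simp
    then have "AE x in lborel. x \<notin> ball e r \<inter> {-\<delta><..<\<delta>}"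
      by eventually_elim (use density_pos in \<open>force simp: indicator_def split: if_splits\<close>)
    then have "emeasure lborel (ball e r \<inter> {-\<delta><..<\<delta>}) = 0"
      by (subst (asm) AE_iff_null_sets[symmetric]) auto
    moreover have "ball e r \<inter> {-\<delta><..<\<delta>} = {max (e - r) (- \<delta>)<..<min (e + r) \<delta>}"
      by (auto simp: dist_real_def)
    ultimately show False using assms by (auto simp: max_def min_def split: if_splits)
  qed
  ultimately show "0 < enn2real m"
    by (simp add: enn2real_positive_iff zero_less_iff_neq_zero)
qed

lemma H_mem: "\<omega> \<in> space M \<Longrightarrow> H n \<omega> \<in> {f, g}"
  using indep_H[unfolded indep_vars_def2] measurable_space[of "H n" M "count_space {f, g}" \<omega>] by auto

lemma orbit_mem: "Y n \<omega> \<in> {0..b}"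
  using y0 truncation_mem[OF b_nonneg] by (cases n) auto

lemma measurable_orbit: "Y n \<in> borel_measurable (past n)"
proof (induction n)
  case 0
  then show ?case by (simp cong: measurable_cong)
next
  case (Suc n)
  have Y [measurable]: "Y n \<in> borel_measurable (past (Suc n))"
    using Suc sets_past_mono[of n "Suc n"] by (auto simp: measurable_def space_past)
  have [measurable]: "\<epsilon> n \<in> borel_measurable (past (Suc n))"
    using coord_in_past(2)[of n "Suc n"] by (auto simp: measurable_def space_past)
  have "H n -` {f} \<inter> space M \<in> sets (past (Suc n))"
    by (rule coord_in_past) auto
  moreover have "H n -` {f} \<inter> space M = {\<omega>\<in>space (past (Suc n)). H n \<omega> = f}"
    by (auto simp: space_past)
  ultimately have [measurable]: "Measurable.pred (past (Suc n)) (\<lambda>\<omega>. H n \<omega> = f)"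
    by (simp add: pred_def)
  \<comment> \<open>Continuity of \<open>f\<close> and \<open>g\<close> is given on
    \<open>[0,b]\<close>. Precomposition with \<open>truncation b\<close> makes them continuous on
    the whole line and changes nothing along the orbit.\<close>
  have trunc: "continuous_on UNIV (truncation b)"
    unfolding truncation_eq[OF b_nonneg] by (intro continuous_intros)
  have "truncation b ` UNIV \<subseteq> {0..b}"
    using truncation_mem[OF b_nonneg] by auto
  then have ext: "(\<lambda>x. h (truncation b x)) \<in> borel_measurable borel" if "h \<in> {f, g}" for h
    by (intro borel_measurable_continuous_onI continuous_on_compose2[OF cont[OF that] trunc])
  note [measurable] = ext[of f, simplified] ext[of g, simplified]
    borel_measurable_continuous_onI[OF trunc]
  have "(\<lambda>\<omega>. truncation b ((if H n \<omega> = f then f (truncation b (Y n \<omega>)) else g (truncation b (Y n \<omega>))) + \<epsilon> n \<omega>))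
      \<in> borel_measurable (past (Suc n))"
    by measurable
  moreover have "Y (Suc n) \<omega> =
      truncation b ((if H n \<omega> = f then f (truncation b (Y n \<omega>)) else g (truncation b (Y n \<omega>))) + \<epsilon> n \<omega>)"
    if "\<omega> \<in> space (past (Suc n))" for \<omega>
    using H_mem[of \<omega> n] that by (auto simp: truncation_id[OF orbit_mem] space_past)
  ultimately show ?case
    by (subst measurable_cong)
qed

lemma orbit_event: "B \<in> sets borel \<Longrightarrow> {\<omega>\<in>space M. Y n \<omega> \<in> B} \<in> sets (past n)"
  using measurable_sets[OF measurable_orbit, of B n] by (simp add: space_past vimage_def Int_def conj_commute)

lemma orbit_below_event: "{\<omega>\<in>space M. Y n \<omega> < u} \<in> sets (past n)"
  using orbit_event[of "{..<u}" n] by simp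

text \<open>Almost surely all noises stay below \<open>\<delta>\<close> simultaneously, as there are
  countably many of them. The inequality in \<open>trap\<close> then becomes strict at every
  step.\<close>

lemma AE_trapped: "AE \<omega> in M. \<forall>n m. n \<le> m \<longrightarrow> Y n \<omega> < u \<longrightarrow> Y m \<omega> < u"
proof -
  have "AE \<omega> in M. \<forall>n. \<epsilon> n \<omega> \<in> {-\<delta><..<\<delta>}"
    using noise_bounded by (simp add: AE_all_countable)
  then show ?thesis
  proof (rule AE_mp, intro AE_I2 impI allI)
    fix \<omega> n m assume \<omega>: "\<omega> \<in> space M" "\<forall>n. \<epsilon> n \<omega> \<in> {-\<delta><..<\<delta>}" and "n \<le> m" "Y n \<omega> < u"
    from \<open>n \<le> m\<close> show "Y m \<omega> < u"
    proof (induction rule: dec_induct)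
      case base
      show ?case by fact
    next
      case (step m)
      then have "H m \<omega> (Y m \<omega>) + \<delta> \<le> u"
        using trap[OF H_mem[OF \<omega>(1)], of "Y m \<omega>" m] orbit_mem[of m \<omega>] by simp
      then have "H m \<omega> (Y m \<omega>) + \<epsilon> m \<omega> < u" using \<omega>(2)[rule_format, of m] by simp
      then show ?case using trap_pos by (auto simp: truncation_def)
    qed
  qed
qed

section \<open>Accessible sets\<close>

text \<open>A lower bound on the transition probability into the trap, uniform in the starting point
  and the time. Testing against all past events \<open>E\<close> replaces conditioning on the state
  and lets such bounds be chained.\<close>

definition accessible :: "real set \<Rightarrow> bool" where
  "accessible S \<longleftrightarrow> (\<exists>n c. 0 < c \<and> (\<forall>k. \<forall>E\<in>sets (past k). (\<forall>\<omega>\<in>E. Y k \<omega> \<in> S) \<longrightarrow>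
      c * prob E \<le> prob (E \<inter> {\<omega>\<in>space M. Y (k + n) \<omega> < u})))"

lemma accessible_subset: "accessible S \<Longrightarrow> T \<subseteq> S \<Longrightarrow> accessible T"
  unfolding accessible_def by (meson subsetD)

lemma accessible_trap: "accessible {..<u}"
  unfolding accessible_def
proof (intro exI[of _ "0 :: nat"] exI[of _ "1 :: real"] conjI allI ballI impI)
  fix k E assume E: "E \<in> sets (past k)" "\<forall>\<omega>\<in>E. Y k \<omega> \<in> {..<u}"
  then have "E \<inter> {\<omega>\<in>space M. Y (k + 0) \<omega> < u} = E"
    using sets.sets_into_space[OF E(1)] by (auto simp: space_past)
  then show "1 * prob E \<le> prob (E \<inter> {\<omega>\<in>space M. Y (k + 0) \<omega> < u})" by simp
qed simp

text \<open>Since the trap is never left, the number of steps in an accessibility bound may be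
  increased freely.\<close>

lemma prob_below_mono:
  assumes "E \<in> events" "m \<le> n"
  shows "prob (E \<inter> {\<omega>\<in>space M. Y m \<omega> < u}) \<le> prob (E \<inter> {\<omega>\<in>space M. Y n \<omega> < u})"
proof (rule finite_measure_mono_AE)
  show "AE \<omega> in M. \<omega> \<in> E \<inter> {\<omega>\<in>space M. Y m \<omega> < u} \<longrightarrow> \<omega> \<in> E \<inter> {\<omega>\<in>space M. Y n \<omega> < u}"
    using AE_trapped by eventually_elim (use assms in auto)
  show "E \<inter> {\<omega>\<in>space M. Y n \<omega> < u} \<in> events"
    using assms orbit_below_event[of n] sets_past_subset by auto
qed

text \<open>The larger step number and the smaller constant serve both sets.\<close>

lemma accessible_Un:
  assumes S: "accessible S" "S \<in> sets borel" and T: "accessible T"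
  shows "accessible (S \<union> T)"
proof -
  obtain n1 c1 where 1: "0 < c1" "\<And>k E. E \<in> sets (past k) \<Longrightarrow> \<forall>\<omega>\<in>E. Y k \<omega> \<in> S \<Longrightarrow>
      c1 * prob E \<le> prob (E \<inter> {\<omega>\<in>space M. Y (k + n1) \<omega> < u})"
    using S(1) unfolding accessible_def by blast
  obtain n2 c2 where 2: "0 < c2" "\<And>k E. E \<in> sets (past k) \<Longrightarrow> \<forall>\<omega>\<in>E. Y k \<omega> \<in> T \<Longrightarrow>
      c2 * prob E \<le> prob (E \<inter> {\<omega>\<in>space M. Y (k + n2) \<omega> < u})"
    using T unfolding accessible_def by blast
  define n where "n = max n1 n2"
  define c where "c = min c1 c2"
  show ?thesis
    unfolding accessible_def
  proof (intro exI[of _ n] exI[of _ c] conjI allI ballI impI)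
    show "0 < c" using 1 2 by (simp add: c_def)
    fix k E assume E: "E \<in> sets (past k)" "\<forall>\<omega>\<in>E. Y k \<omega> \<in> S \<union> T"
    \<comment> \<open>Only membership in \<open>S\<close> is tested: on the rest of \<open>E\<close>
      the state lies in \<open>T\<close>.\<close>
    define E1 where "E1 = E \<inter> {\<omega>\<in>space M. Y k \<omega> \<in> S}"
    define E2 where "E2 = E - E1"
    have sub: "E \<subseteq> space M" using sets.sets_into_space[OF E(1)] by (simp add: space_past)
    have E1: "E1 \<in> sets (past k)" and E2: "E2 \<in> sets (past k)"
      using E orbit_event[OF S(2), of k] by (auto simp: E1_def E2_def)
    have ev: "E \<in> events" "E1 \<in> events" "E2 \<in> events" using E E1 E2 sets_past_subset by auto
    let ?G = "{\<omega>\<in>space M. Y (k + n) \<omega> < u}"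
    have G: "?G \<in> events" using orbit_below_event sets_past_subset by auto
    have "c * prob E1 \<le> c1 * prob E1" "c * prob E2 \<le> c2 * prob E2"
      by (auto simp: c_def intro: mult_right_mono)
    moreover have "c1 * prob E1 \<le> prob (E1 \<inter> {\<omega>\<in>space M. Y (k + n1) \<omega> < u})"
      by (rule 1(2)[OF E1]) (simp add: E1_def)
    moreover have "c2 * prob E2 \<le> prob (E2 \<inter> {\<omega>\<in>space M. Y (k + n2) \<omega> < u})"
      by (rule 2(2)[OF E2]) (use E sub in \<open>auto simp: E1_def E2_def\<close>)
    moreover have "prob (E1 \<inter> {\<omega>\<in>space M. Y (k + n1) \<omega> < u}) \<le> prob (E1 \<inter> ?G)"
      "prob (E2 \<inter> {\<omega>\<in>space M. Y (k + n2) \<omega> < u}) \<le> prob (E2 \<inter> ?G)"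
      by (auto intro!: prob_below_mono ev simp: n_def)
    moreover have "prob E = prob E1 + prob E2"
      using finite_measure_Union[OF ev(2,3)] by (simp add: E2_def Un_absorb1 E1_def Diff_disjoint Un_Diff_cancel)
    moreover have "prob (E \<inter> ?G) = prob (E1 \<inter> ?G) + prob (E2 \<inter> ?G)"
      using finite_measure_Union[of "E1 \<inter> ?G" "E2 \<inter> ?G"] ev G
      by (simp add: Int_Un_distrib2[symmetric] E2_def) (auto simp: E1_def Un_absorb1)
    ultimately show "c * prob E \<le> prob (E \<inter> ?G)" by (simp add: distrib_left)
  qed
qed

text \<open>If the map is \<open>h\<close> and the noise is near \<open>e\<close>, a state near
  \<open>y\<close> moves close to the given target. This has probability bounded below, and the
  target's accessibility does the rest.\<close>

lemma accessible_step:
  assumes y: "y \<in> {0..b}" and h: "h \<in> {f, g}" and e: "\<bar>e\<bar> < \<delta>"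
    and r: "0 < r" "accessible (ball (truncation b (h y + e)) r)"
  shows "\<exists>s>0. accessible (ball y s)"
proof -
  define z where "z = truncation b (h y + e)"
  obtain n c where c: "0 < c" "\<And>k E. E \<in> sets (past k) \<Longrightarrow> \<forall>\<omega>\<in>E. Y k \<omega> \<in> ball z r \<Longrightarrow>
      c * prob E \<le> prob (E \<inter> {\<omega>\<in>space M. Y (k + n) \<omega> < u})"
    using r(2) unfolding accessible_def z_def by blast
  have "0 < r / 2" using r by simp
  then obtain s where s: "0 < s" "\<And>x. x \<in> {0..b} \<Longrightarrow> dist x y < s \<Longrightarrow> dist (h x) (h y) < r / 2"
    using cont[OF h] y unfolding continuous_on_iff by meson
  obtain d where d: "0 < d" "\<And>k. prob (\<epsilon> k -` ball e (r / 2) \<inter> space M) = d"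
    using prob_noise_ball[OF \<open>0 < r / 2\<close> e] by blast
  \<comment> \<open>A common lower bound for the two choices of map, whichever of them
    \<open>h\<close> is.\<close>
  define q where "q = min p (1 - p)"
  have "0 < q" using p by (simp add: q_def)
  have q: "q \<le> prob (H k -` {h} \<inter> space M)" for k
  proof -
    have "H k -` {h} \<inter> space M = {\<omega>\<in>space M. H k \<omega> = h}" by auto
    then show ?thesis using h prob_f[of k] prob_g[of k] by (auto simp: q_def)
  qed
  have "accessible (ball y s)"
    unfolding accessible_def
  proof (intro exI[of _ "Suc n"] exI[of _ "c * q * d"] conjI allI ballI impI)
    show "0 < c * q * d" using c \<open>0 < q\<close> d by simp
    fix k E assume E: "E \<in> sets (past k)" "\<forall>\<omega>\<in>E. Y k \<omega> \<in> ball y s"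
    \<comment> \<open>\<open>E'\<close> belongs to the past of time \<open>Suc k\<close>, so the
      accessibility of the target ball can be applied to it there.\<close>
    define E' where "E' = E \<inter> (H k -` {h} \<inter> space M) \<inter> (\<epsilon> k -` ball e (r / 2) \<inter> space M)"
    have E': "E' \<in> sets (past (Suc k))"
      unfolding E'_def
    proof (intro sets.Int[OF sets.Int])
      show "E \<in> sets (past (Suc k))" using E(1) sets_past_mono[of k "Suc k"] by auto
      show "H k -` {h} \<inter> space M \<in> sets (past (Suc k))" by (rule coord_in_past) (use h in auto)
      show "\<epsilon> k -` ball e (r / 2) \<inter> space M \<in> sets (past (Suc k))" by (rule coord_in_past) auto
    qed
    have near: "\<forall>\<omega>\<in>E'. Y (Suc k) \<omega> \<in> ball z r"
    proof
      fix \<omega> assume \<omega>: "\<omega> \<in> E'"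
      then have \<omega>': "\<omega> \<in> E" "H k \<omega> = h" "\<epsilon> k \<omega> \<in> ball e (r / 2)" by (simp_all add: E'_def)
      have "Y k \<omega> \<in> ball y s" using E(2) \<omega>'(1) by (rule bspec)
      then have "dist (Y k \<omega>) y < s" by (simp add: dist_commute)
      then have "dist (h (Y k \<omega>)) (h y) < r / 2" by (rule s(2)[OF orbit_mem])
      moreover have "dist (\<epsilon> k \<omega>) e < r / 2" using \<omega>'(3) by (simp add: dist_commute)
      ultimately have "dist (h (Y k \<omega>) + \<epsilon> k \<omega>) (h y + e) < r"
        unfolding dist_real_def by linarith
      then have "dist (truncation b (h (Y k \<omega>) + \<epsilon> k \<omega>)) z < r"
        unfolding z_def using truncation_nonexpansive[OF b_nonneg] by (rule le_less_trans[rotated])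
      then show "Y (Suc k) \<omega> \<in> ball z r" using \<omega>'(2) by (simp add: dist_commute)
    qed
    have "c * q * d * prob E = c * (prob E * q * d)" by simp
    also have "\<dots> \<le> c * (prob E * prob (H k -` {h} \<inter> space M) * d)"
      using c d q by (intro mult_left_mono mult_right_mono) auto
    also have "\<dots> = c * prob E'"
      unfolding E'_def using prob_one_step[OF E(1), of "{h}" "ball e (r / 2)"] h d by simp
    also have "\<dots> \<le> prob (E' \<inter> {\<omega>\<in>space M. Y (Suc k + n) \<omega> < u})"
      by (rule c(2)[OF E' near])
    also have "\<dots> \<le> prob (E \<inter> {\<omega>\<in>space M. Y (k + Suc n) \<omega> < u})"
      using E sets_past_subset orbit_below_event[of "k + Suc n"]
      by (intro finite_measure_mono) (auto simp: E'_def)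
    finally show "c * q * d * prob E \<le> prob (E \<inter> {\<omega>\<in>space M. Y (k + Suc n) \<omega> < u})" .
  qed
  then show ?thesis using s(1) by blast
qed

section \<open>Almost sure absorption\<close>

text \<open>The points that are not \<open>good\<close> form an invariant compact set avoiding
  \<open>0\<close>, empty by \<open>no_inv\<close>. Local accessibility then becomes global, and the
  time to absorption has a geometric tail.\<close>

lemma eventually_trapped:
  assumes no_inv: "\<And>C. compact C \<Longrightarrow> C \<subseteq> {0..b} \<Longrightarrow> 0 \<notin> C \<Longrightarrow>
      (\<And>y h e. y \<in> C \<Longrightarrow> h \<in> {f, g} \<Longrightarrow> \<bar>e\<bar> < \<delta> \<Longrightarrow> truncation b (h y + e) \<in> C) \<Longrightarrow> C = {}"
  shows "AE \<omega> in M. \<exists>n\<^sub>0. \<forall>n\<ge>n\<^sub>0. Y n \<omega> \<in> {0..<u}"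
proof -
  define good where "good y \<longleftrightarrow> (\<exists>r>0. accessible (ball y r))" for y
  have "open {y. good y}"
    unfolding open_contains_ball
  proof
    fix y assume "y \<in> {y. good y}"
    then obtain r where r: "0 < r" "accessible (ball y r)" by (auto simp: good_def)
    have "good x" if "x \<in> ball y r" for x
    proof -
      obtain s where "0 < s" "ball x s \<subseteq> ball y r"
        using \<open>x \<in> ball y r\<close> open_ball open_contains_ball by metis
      then show ?thesis using accessible_subset r by (auto simp: good_def)
    qed
    then show "\<exists>e>0. ball y e \<subseteq> {y. good y}" using r by blast
  qed
  then have "compact ({0..b} - {y. good y})" by (intro compact_diff) auto
  moreover have "good 0"
    unfolding good_def
    by (rule exI[of _ u]) (auto intro!: accessible_subset[OF accessible_trap] trap_pos simp: dist_real_def)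
  \<comment> \<open>The contrapositive of \<open>accessible_step\<close>.\<close>
  moreover have "truncation b (h y + e) \<in> {0..b} - {y. good y}"
    if "y \<in> {0..b} - {y. good y}" "h \<in> {f, g}" "\<bar>e\<bar> < \<delta>" for y h e
    using that accessible_step[of y h e] truncation_mem[OF b_nonneg] by (auto simp: good_def)
  ultimately have "{0..b} - {y. good y} = {}" by (intro no_inv) auto
  then have all_good: "good y" if "y \<in> {0..b}" for y using that by blast
  \<comment> \<open>Bisection plays the role of a finite subcover: short intervals lie in accessible
    balls, and adjacent accessible intervals are glued by \<open>accessible_Un\<close>.\<close>
  have "accessible {0..b}"
  proof (rule Bolzano[where P = "\<lambda>x y. accessible {x..y}", OF b_nonneg])
    fix x y z assume "accessible {x..y}" "accessible {y..z}" and "x \<le> y" "y \<le> z"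
    then have "accessible ({x..y} \<union> {y..z})" by (intro accessible_Un) auto
    then show "accessible {x..z}"
      using \<open>x \<le> y\<close> \<open>y \<le> z\<close> by (simp add: ivl_disj_un_two_touch)
  next
    fix x assume "0 \<le> x" "x \<le> b"
    then obtain r where r: "0 < r" "accessible (ball x r)" using all_good[of x] by (auto simp: good_def)
    have "accessible {s..t}" if "s \<le> x" "x \<le> t" "t - s < r" for s t
      by (rule accessible_subset[OF r(2)]) (use that in \<open>auto simp: dist_real_def\<close>)
    then show "\<exists>d>0. \<forall>s t. s \<le> x \<and> x \<le> t \<and> t - s < d \<longrightarrow> accessible {s..t}"
      using r(1) by blast
  qed
  then obtain n c where "0 < c" and nc: "\<And>k E. E \<in> sets (past k) \<Longrightarrow> \<forall>\<omega>\<in>E. Y k \<omega> \<in> {0..b} \<Longrightarrow>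
      c * prob E \<le> prob (E \<inter> {\<omega>\<in>space M. Y (k + n) \<omega> < u})"
    unfolding accessible_def by blast
  have c: "c * prob E \<le> prob (E \<inter> {\<omega>\<in>space M. Y (k + n) \<omega> < u})" if "E \<in> sets (past k)" for k E
    by (rule nc[OF that]) (intro ballI orbit_mem)
  define D where "D k = {\<omega>\<in>space M. \<not> Y k \<omega> < u}" for k
  have D_past: "D k \<in> sets (past k)" for k
    using orbit_event[of "{u..}" k] by (simp add: D_def not_less)
  then have D: "D k \<in> events" for k using sets_past_subset by blast
  \<comment> \<open>Accessibility is applied to the event \<open>D k\<close> itself: at least the
    fraction \<open>c\<close> of it is absorbed within \<open>n\<close> steps, and absorbed orbits
    almost surely do not return.\<close>
  have decay: "prob (D (k + n)) \<le> (1 - c) * prob (D k)" for k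
  proof -
    have "AE \<omega> in M. \<omega> \<in> D (k + n) \<longrightarrow> \<omega> \<in> D k - {\<omega>\<in>space M. Y (k + n) \<omega> < u}"
      using AE_trapped
    proof eventually_elim
      case (elim \<omega>)
      then have "Y k \<omega> < u \<Longrightarrow> Y (k + n) \<omega> < u" using le_add1 by blast
      then show ?case by (auto simp: D_def)
    qed
    then have "prob (D (k + n)) \<le> prob (D k - {\<omega>\<in>space M. Y (k + n) \<omega> < u})"
      using D orbit_below_event[of "k + n"] sets_past_subset by (intro finite_measure_mono_AE) auto
    also have "\<dots> = prob (D k) - prob (D k \<inter> {\<omega>\<in>space M. Y (k + n) \<omega> < u})"
      using D orbit_below_event[of "k + n"] sets_past_subset by (intro finite_measure_Diff') auto
    also have "\<dots> \<le> (1 - c) * prob (D k)"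
      using c[OF D_past, of k] by (simp add: algebra_simps)
    finally show ?thesis .
  qed
  \<comment> \<open>Capping at \<open>1\<close> keeps the ratio \<open>1 - c'\<close> in
    \<open>[0,1)\<close>, as the definition of \<open>accessible\<close> states no upper bound on
    \<open>c\<close>.\<close>
  define c' where "c' = min c 1"
  have c': "0 \<le> 1 - c'" "1 - c' < 1" "1 - c \<le> 1 - c'" using \<open>0 < c\<close> by (auto simp: c'_def)
  have geometric: "prob (D (j * n)) \<le> (1 - c') ^ j" for j
  proof (induction j)
    case (Suc j)
    have "prob (D (Suc j * n)) \<le> (1 - c) * prob (D (j * n))"
      using decay[of "j * n"] by (simp add: add.commute)
    also have "\<dots> \<le> (1 - c') * prob (D (j * n))"
      using c' by (intro mult_right_mono) auto
    also have "\<dots> \<le> (1 - c') * (1 - c') ^ j"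
      using c' Suc by (intro mult_left_mono) auto
    finally show ?case by simp
  qed simp
  have "prob (\<Inter>k. D k) \<le> (1 - c') ^ j" for j
    using D by (intro order_trans[OF finite_measure_mono geometric]) auto
  moreover have "(\<lambda>j. (1 - c') ^ j) \<longlonglongrightarrow> 0"
    using c' by (intro LIMSEQ_realpow_zero)
  ultimately have "prob (\<Inter>k. D k) \<le> 0"
    by (intro LIMSEQ_le_const) auto
  then have "(\<Inter>k. D k) \<in> null_sets M"
    using D by (auto simp: null_sets_def emeasure_eq_measure measure_le_0_iff)
  then have "AE \<omega> in M. \<omega> \<notin> (\<Inter>k. D k)" by (rule AE_not_in)
  then show ?thesis
    using AE_trapped AE_space
  proof eventually_elim
    case (elim \<omega>)
    then obtain k where "Y k \<omega> < u" by (auto simp: D_def)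
    then show ?case using elim(2) orbit_mem[of _ \<omega>] by auto
  qed
qed

end

theorem theorem5:
  fixes M :: "'w measure"
    and f g :: "real \<Rightarrow> real"
    and b A\<^sub>f K\<^sub>f B\<^sub>f A\<^sub>g K\<^sub>g B\<^sub>g p \<delta> :: real
    and H :: "nat \<Rightarrow> 'w \<Rightarrow> real \<Rightarrow> real"
    and \<epsilon> :: "nat \<Rightarrow> 'w \<Rightarrow> real"
    and \<rho> :: "real \<Rightarrow> ennreal"
    and U :: "real set"
  assumes "prob_space M"
    and "unimodal_allee_map b f A\<^sub>f K\<^sub>f B\<^sub>f"
    and "unimodal_allee_map b g A\<^sub>g K\<^sub>g B\<^sub>g"
    and "b = max (f B\<^sub>f) (g B\<^sub>g)"
    and "0 < p" and "p < 1" and "0 < \<delta>"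
    and "prob_space.indep_vars M (\<lambda>_. count_space {f, g}) H UNIV"
    and "\<And>n. measure M {\<omega>\<in>space M. H n \<omega> = f} = p"
    and "\<And>n. measure M {\<omega>\<in>space M. H n \<omega> = g} = 1 - p"
    and "prob_space.indep_vars M (\<lambda>_. borel) \<epsilon> UNIV"
    and "\<And>n. distributed M lborel (\<epsilon> n) \<rho>"
    and "\<And>n. AE \<omega> in M. \<epsilon> n \<omega> \<in> {-\<delta><..<\<delta>}"
    and "\<And>x. x \<in> {-\<delta><..<\<delta>} \<Longrightarrow> 0 < \<rho> x"
    and "indep_random_elements M
           (Pi\<^sub>M UNIV (\<lambda>_. count_space {f, g})) (\<lambda>\<omega> n. H n \<omega>)
           (Pi\<^sub>M UNIV (\<lambda>_. borel)) (\<lambda>\<omega> n. \<epsilon> n \<omega>)"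
    and "\<And>x. x \<in> {B\<^sub>f<..<f B\<^sub>f} \<Longrightarrow> f differentiable (at x) \<and> \<bar>deriv f x\<bar> < 1"
    and "\<exists>hs. hs \<noteq> [] \<and> set hs \<subseteq> {f, g} \<and> foldr (\<circ>) hs id K\<^sub>f < A\<^sub>f"
    and "U = {x \<in> {0..min A\<^sub>f A\<^sub>g}. min (x - f x) (x - g x) \<ge> \<delta>}"
    and "U \<noteq> {}"
  shows "\<forall>y\<^sub>0\<in>{0..b}.
    measure M {\<omega>\<in>space M. \<exists>n\<^sub>0. \<forall>n\<ge>n\<^sub>0. random_orbit b H \<epsilon> y\<^sub>0 n \<omega> \<in> {0..<Inf U}} = 1"
proof
  fix y\<^sub>0 assume "y\<^sub>0 \<in> {0..b}"
  note f = assms(2) and g = assms(3) and U = assms(18)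
  note bf = unimodal_allee_bounds[OF f] and bg = unimodal_allee_bounds[OF g]
  have maps: "f \<in> {0..b} \<rightarrow> {0..b}" "g \<in> {0..b} \<rightarrow> {0..b}"
    and cont: "continuous_on {0..b} f" "continuous_on {0..b} g"
    using f g by (auto simp: unimodal_allee_map_def allee_map_def)
  have zero: "f 0 = 0" "g 0 = 0"
  proof -
    have "0 \<in> {x\<in>{0..b}. f x = x}" "0 \<in> {x\<in>{0..b}. g x = x}"
      using f g by (auto simp: unimodal_allee_map_def allee_map_def)
    then show "f 0 = 0" "g 0 = 0" by auto
  qed
  \<comment> \<open>Closedness puts \<open>Inf U\<close> into \<open>U\<close>, so both maps drop by
    at least \<open>\<delta>\<close> at \<open>Inf U\<close>.\<close>
  have "closed U"
  proof -
    have "continuous_on {0..min A\<^sub>f A\<^sub>g} (\<lambda>x. min (x - f x) (x - g x))"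
      using bf(10) by (intro continuous_intros continuous_on_subset[OF cont(1)] continuous_on_subset[OF cont(2)]) auto
    from continuous_closed_preimage[OF this closed_real_atLeastAtMost, of "{\<delta>..}"] show ?thesis
      unfolding U by (simp add: vimage_def Int_def conj_commute)
  qed
  then have "Inf U \<in> U"
    using assms(19) U by (intro closed_contains_Inf) (auto intro!: bdd_belowI[of _ 0])
  then have u: "0 \<le> Inf U" "Inf U \<le> A\<^sub>f" "Inf U \<le> A\<^sub>g"
    "f (Inf U) + \<delta> \<le> Inf U" "g (Inf U) + \<delta> \<le> Inf U"
    unfolding U by auto
  have "Inf U \<noteq> 0" using u zero \<open>0 < \<delta>\<close> by auto
  \<comment> \<open>\<open>Inf U\<close> lies to the left of both peaks, so both maps are monotone
    up to it and the drop at \<open>Inf U\<close> bounds their values before it.\<close>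
  have trap: "h x + \<delta> \<le> Inf U" if "h \<in> {f, g}" "x \<in> {0..<Inf U}" for h x
    using unimodal_allee_mono[OF f, of x "Inf U"] unimodal_allee_mono[OF g, of x "Inf U"]
      that u bf(2) bg(2) by fastforce
  interpret prob_space M by fact
  interpret random_system M f g b p \<delta> y\<^sub>0 "Inf U" H \<epsilon> \<rho>
  proof unfold_locales
    show "0 \<le> b" "y\<^sub>0 \<in> {0..b}" using \<open>y\<^sub>0 \<in> {0..b}\<close> by auto
    show "0 < Inf U" using \<open>Inf U \<noteq> 0\<close> u by simp
  qed (use assms cont trap in auto)
  obtain hs where hs: "set hs \<subseteq> {f, g}" "foldr (\<circ>) hs id K\<^sub>f < A\<^sub>f" using assms(17) by blast
  have "AE \<omega> in M. \<exists>n\<^sub>0. \<forall>n\<ge>n\<^sub>0. Y n \<omega> \<in> {0..<Inf U}"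
    by (rule eventually_trapped, rule unimodal_allee_no_invariant_compact[OF f assms(16) maps(2) hs \<open>0 < \<delta>\<close>])
      auto
  moreover have [measurable]: "Y n \<in> borel_measurable M" for n
    using measurable_orbit[of n] sets_past_subset[of n] by (auto simp: measurable_def space_past)
  have "{\<omega>\<in>space M. \<exists>n\<^sub>0. \<forall>n\<ge>n\<^sub>0. Y n \<omega> \<in> {0..<Inf U}} \<in> events"
    by measurable
  ultimately show "prob {\<omega>\<in>space M. \<exists>n\<^sub>0. \<forall>n\<ge>n\<^sub>0. Y n \<omega> \<in> {0..<Inf U}} = 1"
    by (simp add: prob_Collect_eq_1)
qed

end
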